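(* Let $S$ be a semiring and $B$ a McCoy and weak content $S$-semialgebra such that the corresponding homomorphism $\lambda:S\to B$ is injective and the content function $c$ is homogeneous. If $Z(S)$ is a finite union of strong Krull primes of $S$, then $Z(B)$ is a finite union of strong Krull primes of $B$.
   Context: A semiring is a set $S$ with operations $+,\cdot$ such that $(S,+)$ is a commutative monoid with identity $0$, $(S,\cdot)$ is a commutative monoid with identity $1\neq 0$, multiplication distributes over addition, and $s\cdot 0=0$ for all $s\in S$. An ideal of $S$ is a nonempty subset closed under addition and under multiplication by elements of $S$; a proper ideal $\mathbf p$ is prime if $ab\in\mathbf p$ implies $a\in\mathbf p$ or $b\in\mathbf p$. $\sqrt I=\{s\in S:s^n\in I\text{ for some }n\ge1\}$. $Z(S)$ is the set of $s\in S$ with $st=0$ for some nonzero $t\in S$ (similarly $Z(B)$). An $S$-semialgebra is a semiring $B$ with a semiring morphism $\lambda:S\to B$ (preserving $+,\cdot,0,1$); write $s\cdot f=\lambda(s)f$, and for an ideal $I$ of $S$ let $IB$ be the ideal of $B$ generated by $\lambda(I)$. For $f\in B$, the content $c(f)$ is the intersection of all ideals $I$ of $S$ with $f\in IB$. $B$ is an Ohm-Rush $S$-semialgebra if $f\in c(f)B$ for all $f\in B$. An Ohm-Rush $S$-semialgebra $B$ is: a McCoy $S$-semialgebra if $g\cdot f=0$ with $g,f\in B$, $g\neq0$, implies $s\cdot c(f)=0$ for some nonzero $s\in S$; a weak content $S$-semialgebra if $c(f)c(g)\subseteq\sqrt{c(fg)}$ for all $f,g\in B$. The content function is homogeneous if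 $c(s\cdot f)=s\cdot c(f)$ for all $s\in S$, $f\in B$. A prime ideal $\mathbf p$ of a semiring $S$ is a strong Krull prime of $S$ if for every finitely generated ideal $I$ of $S$ with $I\subseteq\mathbf p$ there exists $z\in S$ such that $I\subseteq\mathrm{Ann}(z)\subseteq\mathbf p$, where $\mathrm{Ann}(z)=\{s\in S: sz=0\}$. *)

theory Defs
  imports Main "HOL.Hull"
begin

text \<open>
  The class \<^class>\<open>comm_semiring_1\<close> consists of the commutative semirings with absorbing zero and
  \<open>1 \<noteq> 0\<close>; addition need be neither cancellative nor invertible.
\<close>

definition semiring_ideal :: "'a::comm_semiring_1 set \<Rightarrow> bool" where
  "semiring_ideal I \<longleftrightarrow>
     I \<noteq> {} \<and> (\<forall>x\<in>I. \<forall>y\<in>I. x + y \<in> I) \<and> (\<forall>s. \<forall>x\<in>I. s * x \<in> I)"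

definition prime_semiring_ideal :: "'a::comm_semiring_1 set \<Rightarrow> bool" where
  "prime_semiring_ideal P \<longleftrightarrow>
     semiring_ideal P \<and> P \<noteq> UNIV \<and> (\<forall>a b. a * b \<in> P \<longrightarrow> a \<in> P \<or> b \<in> P)"

abbreviation ideal_generated :: "'a::comm_semiring_1 set \<Rightarrow> 'a set" where
  "ideal_generated X \<equiv> semiring_ideal hull X"

definition fin_gen_ideal :: "'a::comm_semiring_1 set \<Rightarrow> bool" where
  "fin_gen_ideal I \<longleftrightarrow> (\<exists>X. finite X \<and> I = ideal_generated X)"

definition ideal_product :: "'a::comm_semiring_1 set \<Rightarrow> 'a set \<Rightarrow> 'a set" where
  "ideal_product I J = ideal_generated {x * y | x y. x \<in> I \<and> y \<in> J}"

definition ideal_radical :: "'a::comm_semiring_1 set \<Rightarrow> 'a set" where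
  "ideal_radical I = {s. \<exists>n::nat. n \<ge> 1 \<and> s ^ n \<in> I}"

text \<open>As in the source, \<open>0\<close> belongs to this set.\<close>

definition zero_divisors :: "'a::comm_semiring_1 set" where
  "zero_divisors = {s. \<exists>t. t \<noteq> 0 \<and> s * t = 0}"

definition annihilator :: "'a::comm_semiring_1 \<Rightarrow> 'a set" where
  "annihilator z = {s. s * z = 0}"

definition strong_Krull_prime :: "'a::comm_semiring_1 set \<Rightarrow> bool" where
  "strong_Krull_prime P \<longleftrightarrow> prime_semiring_ideal P \<and>
     (\<forall>I. fin_gen_ideal I \<and> I \<subseteq> P \<longrightarrow> (\<exists>z. I \<subseteq> annihilator z \<and> annihilator z \<subseteq> P))"

text \<open>
  An \<open>S\<close>-semialgebra \<open>B\<close> is given by its structure morphism \<open>\<lambda> : S \<rightarrow> B\<close>, where \<open>S\<close> and \<open>B\<close> are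
  the types \<open>'s\<close> and \<open>'b\<close>.
\<close>

definition semialgebra :: "('s::comm_semiring_1 \<Rightarrow> 'b::comm_semiring_1) \<Rightarrow> bool" where
  "semialgebra lam \<longleftrightarrow>
     lam 0 = 0 \<and> lam 1 = 1 \<and>
     (\<forall>x y. lam (x + y) = lam x + lam y) \<and> (\<forall>x y. lam (x * y) = lam x * lam y)"

definition ideal_extension ::
    "('s::comm_semiring_1 \<Rightarrow> 'b::comm_semiring_1) \<Rightarrow> 's set \<Rightarrow> 'b set" where
  "ideal_extension lam I = ideal_generated (lam ` I)"

definition content_ideal ::
    "('s::comm_semiring_1 \<Rightarrow> 'b::comm_semiring_1) \<Rightarrow> 'b \<Rightarrow> 's set" where
  "content_ideal lam f = \<Inter>{I. semiring_ideal I \<and> f \<in> ideal_extension lam I}"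

definition Ohm_Rush_semialgebra :: "('s::comm_semiring_1 \<Rightarrow> 'b::comm_semiring_1) \<Rightarrow> bool" where
  "Ohm_Rush_semialgebra lam \<longleftrightarrow>
     semialgebra lam \<and> (\<forall>f. f \<in> ideal_extension lam (content_ideal lam f))"

definition McCoy_semialgebra :: "('s::comm_semiring_1 \<Rightarrow> 'b::comm_semiring_1) \<Rightarrow> bool" where
  "McCoy_semialgebra lam \<longleftrightarrow> Ohm_Rush_semialgebra lam \<and>
     (\<forall>g f. g * f = 0 \<and> g \<noteq> 0 \<longrightarrow> (\<exists>s. s \<noteq> 0 \<and> (*) s ` content_ideal lam f = {0}))"

definition weak_content_semialgebra ::
    "('s::comm_semiring_1 \<Rightarrow> 'b::comm_semiring_1) \<Rightarrow> bool" where
  "weak_content_semialgebra lam \<longleftrightarrow> Ohm_Rush_semialgebra lam \<and>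
     (\<forall>f g. ideal_product (content_ideal lam f) (content_ideal lam g)
              \<subseteq> ideal_radical (content_ideal lam (f * g)))"

definition homogeneous_content :: "('s::comm_semiring_1 \<Rightarrow> 'b::comm_semiring_1) \<Rightarrow> bool" where
  "homogeneous_content lam \<longleftrightarrow>
     (\<forall>s f. content_ideal lam (lam s * f) = (*) s ` content_ideal lam f)"

definition finite_union_of_strong_Krull_primes :: "'a::comm_semiring_1 set \<Rightarrow> bool" where
  "finite_union_of_strong_Krull_primes Z \<longleftrightarrow>
     (\<exists>\<P>. finite \<P> \<and> (\<forall>P\<in>\<P>. strong_Krull_prime P) \<and> Z = \<Union>\<P>)"

end

theory Submission
  imports Defs
begin

text \<open>
  If \<open>Z(S)\<close> is the union of the strong Krull primes \<open>p\<^sub>i\<close>, then \<open>Z(B)\<close> is the union of the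
  extensions \<open>p\<^sub>i B\<close>.  Membership in an extension is controlled by content: \<open>f \<in> I B\<close> iff
  \<open>c(f) \<subseteq> I\<close>, and \<open>c(f)\<close> is finitely generated, so that the defining property of a strong Krull
  prime applies to it.  Homogeneity gives \<open>\<lambda>(z) f = 0\<close> iff \<open>z c(f) = 0\<close>, which carries
  annihilators from \<open>S\<close> to \<open>B\<close>; weak content makes \<open>p B\<close> prime, and injectivity of \<open>\<lambda>\<close>
  makes it proper.  A zero-divisor \<open>f\<close>
  has \<open>c(f) \<subseteq> Z(S)\<close> by the McCoy property, and prime avoidance places \<open>c(f)\<close> inside one \<open>p\<^sub>i\<close>.
  Prime avoidance needs subtractive ideals in a semiring, and strong Krull primes are subtractive.
\<close>

section \<open>Ideals of semirings\<close>

lemma semiring_idealI: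
  assumes "0 \<in> I" "\<And>x y. x \<in> I \<Longrightarrow> y \<in> I \<Longrightarrow> x + y \<in> I" "\<And>s x. x \<in> I \<Longrightarrow> s * x \<in> I"
  shows "semiring_ideal I"
  using assms unfolding semiring_ideal_def by blast

lemma semiring_ideal_add: "semiring_ideal I \<Longrightarrow> x \<in> I \<Longrightarrow> y \<in> I \<Longrightarrow> x + y \<in> I"
  unfolding semiring_ideal_def by blast

lemma semiring_ideal_mult: "semiring_ideal I \<Longrightarrow> x \<in> I \<Longrightarrow> s * x \<in> I"
  unfolding semiring_ideal_def by blast

lemma semiring_ideal_0: "semiring_ideal I \<Longrightarrow> 0 \<in> I"
  unfolding semiring_ideal_def by (metis ex_in_conv mult_zero_left)

lemma semiring_ideal_zero: "semiring_ideal {0}"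
  by (rule semiring_idealI) auto

lemma semiring_ideal_Inter: "(\<And>I. I \<in> \<I> \<Longrightarrow> semiring_ideal I) \<Longrightarrow> semiring_ideal (\<Inter>\<I>)"
  by (rule semiring_idealI)
    (auto intro: semiring_ideal_0 semiring_ideal_add semiring_ideal_mult)

lemma semiring_ideal_ideal_generated: "semiring_ideal (ideal_generated X)"
  by (rule hull_in) (auto intro: semiring_ideal_Inter)

lemma semiring_ideal_annihilator: "semiring_ideal (annihilator z)"
  by (rule semiring_idealI) (auto simp: annihilator_def distrib_right mult.assoc)

text \<open>The hull is an intersection and gives no formula for its elements. Instead, the elements
  generated by finite subsets of \<open>Y\<close> form an ideal containing \<open>Y\<close>.\<close>

lemma ideal_generated_finite_subset:
  assumes "x \<in> ideal_generated Y"
  shows "\<exists>X. finite X \<and> X \<subseteq> Y \<and> x \<in> ideal_generated X"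
proof -
  let ?J = "{x. \<exists>X. finite X \<and> X \<subseteq> Y \<and> x \<in> ideal_generated X}"
  have "semiring_ideal ?J"
  proof (rule semiring_idealI)
    show "0 \<in> ?J"
      using semiring_ideal_0[OF semiring_ideal_ideal_generated] by blast
  next
    fix x y assume "x \<in> ?J" "y \<in> ?J"
    then obtain X X' where *: "finite X" "X \<subseteq> Y" "x \<in> ideal_generated X"
        "finite X'" "X' \<subseteq> Y" "y \<in> ideal_generated X'"
      by blast
    have "x \<in> ideal_generated (X \<union> X')" "y \<in> ideal_generated (X \<union> X')"
      using * hull_mono[of X "X \<union> X'" semiring_ideal] hull_mono[of X' "X \<union> X'" semiring_ideal]
      by auto
    hence "x + y \<in> ideal_generated (X \<union> X')"
      by (rule semiring_ideal_add[OF semiring_ideal_ideal_generated])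
    with * show "x + y \<in> ?J" by (auto intro!: exI[of _ "X \<union> X'"])
  next
    fix s x assume "x \<in> ?J"
    thus "s * x \<in> ?J"
      using semiring_ideal_mult[OF semiring_ideal_ideal_generated] by blast
  qed
  moreover have "Y \<subseteq> ?J"
  proof
    fix y assume "y \<in> Y"
    thus "y \<in> ?J" using hull_subset[of "{y}" semiring_ideal] by (auto intro!: exI[of _ "{y}"])
  qed
  ultimately have "ideal_generated Y \<subseteq> ?J" by (rule hull_minimal[rotated])
  with assms show ?thesis by blast
qed

section \<open>Prime avoidance for subtractive primes\<close>

lemma prime_semiring_ideal_prod:
  assumes "prime_semiring_ideal P" "finite A" "prod x A \<in> P"
  shows "\<exists>a\<in>A. x a \<in> P"
  using assms(2,3)
proof (induction A rule: finite_induct)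
  case empty
  \<comment> \<open>The empty product is \<open>1\<close>, which a proper ideal cannot
    contain.\<close>
  hence "s \<in> P" for s
    using assms(1) semiring_ideal_mult[of P 1 s] by (simp add: prime_semiring_ideal_def)
  thus ?case using assms(1) unfolding prime_semiring_ideal_def by blast
next
  case (insert a A)
  thus ?case using assms(1) unfolding prime_semiring_ideal_def by auto
qed

lemma prod_in_semiring_ideal:
  assumes "semiring_ideal I" "finite A" "a \<in> A" "x a \<in> I"
  shows "prod x A \<in> I"
  using assms semiring_ideal_mult[of I "x a" "prod x (A - {a})"]
  by (simp add: prod.remove[of A a] mult.commute)

text \<open>In a subfamily \<open>G\<close> that covers \<open>I\<close> with the fewest members,
  each \<open>P\<close> has an element \<open>x P\<close> of \<open>I\<close> lying in no other
  member. If \<open>G\<close> has at least two members, adding to one \<open>x P\<close> the product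
  of the remaining ones gives an element of \<open>I\<close> in no member of \<open>G\<close>;
  subtractivity replaces the usual subtraction.\<close>

lemma prime_avoidance_subtractive:
  assumes fin: "finite F" and I: "semiring_ideal I" and sub: "I \<subseteq> \<Union>F"
    and prime: "\<And>P. P \<in> F \<Longrightarrow> prime_semiring_ideal P"
    and subtractive: "\<And>P a b. P \<in> F \<Longrightarrow> a \<in> P \<Longrightarrow> a + b \<in> P \<Longrightarrow> b \<in> P"
  shows "\<exists>P\<in>F. I \<subseteq> P"
proof -
  have "\<exists>G. (G \<subseteq> F \<and> I \<subseteq> \<Union>G) \<and> (\<forall>H. H \<subseteq> F \<and> I \<subseteq> \<Union>H \<longrightarrow> card G \<le> card H)"
    using sub by (intro ex_has_least_nat) auto
  then obtain G where G: "G \<subseteq> F" "I \<subseteq> \<Union>G"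
      and min: "\<forall>H. H \<subseteq> F \<and> I \<subseteq> \<Union>H \<longrightarrow> card G \<le> card H"
    by (elim exE conjE)
  have finG: "finite G" using G(1) fin finite_subset by blast
  have "\<exists>x. x \<in> I \<and> x \<notin> \<Union>(G - {P})" if "P \<in> G" for P
  proof (rule ccontr)
    assume "\<not> ?thesis"
    hence "card G \<le> card (G - {P})" using G(1) by (intro min[rule_format]) auto
    thus False using card_Diff1_less[OF finG that] by simp
  qed
  then obtain x where xI: "\<And>P. P \<in> G \<Longrightarrow> x P \<in> I"
      and xout: "\<And>P. P \<in> G \<Longrightarrow> x P \<notin> \<Union>(G - {P})"
    by metis
  obtain P where P: "P \<in> G" using semiring_ideal_0[OF I] G(2) by auto
  show ?thesis
  proof (cases "G = {P}")
    case True
    thus ?thesis using G by auto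
  next
    case False
    then obtain Q where Q: "Q \<in> G - {P}" using P by blast
    let ?v = "prod x (G - {P})"
    \<comment> \<open>\<open>Q\<close> keeps the product nonempty; without a factor,
      \<open>?v\<close> would be \<open>1\<close>, which need not lie in \<open>I\<close>.\<close>
    have "?v \<in> I" using prod_in_semiring_ideal[OF I _ Q] xI Q finG by auto
    hence "x P + ?v \<in> I" using semiring_ideal_add[OF I] xI P by blast
    then obtain R where R: "R \<in> G" "x P + ?v \<in> R" using G(2) by blast
    have primeR: "prime_semiring_ideal R" using R(1) G(1) prime by blast
    show ?thesis
    proof (cases "R = P")
      case True
      \<comment> \<open>Some member of \<open>G\<close> contains \<open>x P\<close>, and it can only
        be \<open>P\<close>.\<close>
      have "x P \<in> P" using xI[OF P] xout[OF P] G(2) by blast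
      hence "?v \<in> P" using subtractive[of P "x P" ?v] R True G(1) by blast
      then obtain S where "S \<in> G - {P}" "x S \<in> P"
        using prime_semiring_ideal_prod[of P "G - {P}" x] primeR True finG by auto
      thus ?thesis using xout[of S] P by blast
    next
      case False
      have "x R \<in> R" using xI[OF R(1)] xout[OF R(1)] G(2) by blast
      \<comment> \<open>Now \<open>R\<close> is among the indices of the product, so
        \<open>?v\<close> has the factor \<open>x R\<close>; subtractivity then forces
        \<open>x P\<close> into \<open>R\<close>.\<close>
      hence "?v \<in> R"
        using prod_in_semiring_ideal[of R "G - {P}" R x] primeR R(1) False finG
        by (auto simp: prime_semiring_ideal_def)
      hence "x P \<in> R" using subtractive[of R ?v "x P"] R G(1) by (auto simp: add.commute)
      thus ?thesis using xout[OF P] R(1) False by blast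
    qed
  qed
qed

section \<open>Strong Krull primes\<close>

text \<open>\<open>z\<close> is nonzero because \<open>annihilator 0\<close> is the whole semiring,
  while \<open>P\<close> is proper.\<close>

lemma strong_Krull_primeD:
  assumes "strong_Krull_prime P" "finite X" "X \<subseteq> P"
  obtains z where "ideal_generated X \<subseteq> annihilator z" "annihilator z \<subseteq> P" "z \<noteq> 0"
proof -
  have P: "semiring_ideal P" "P \<noteq> UNIV"
    using assms(1) by (auto simp: strong_Krull_prime_def prime_semiring_ideal_def)
  have "ideal_generated X \<subseteq> P" using assms(3) P(1) by (rule hull_minimal)
  moreover have "fin_gen_ideal (ideal_generated X)" using assms(2) by (auto simp: fin_gen_ideal_def)
  ultimately obtain z where z: "ideal_generated X \<subseteq> annihilator z" "annihilator z \<subseteq> P"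
    using assms(1) unfolding strong_Krull_prime_def by blast
  moreover have "z \<noteq> 0" using z(2) P(2) by (auto simp: annihilator_def)
  ultimately show ?thesis using that by blast
qed

text \<open>One \<open>z\<close> kills both \<open>a\<close> and \<open>a + b\<close>, so
  \<open>b * z = a * z + b * z = 0\<close>, and \<open>annihilator z\<close> lies in
  \<open>P\<close>.\<close>

lemma strong_Krull_prime_subtractive:
  assumes "strong_Krull_prime P" "a \<in> P" "a + b \<in> P"
  shows "b \<in> P"
proof -
  obtain z where z: "ideal_generated {a, a + b} \<subseteq> annihilator z" "annihilator z \<subseteq> P"
    by (rule strong_Krull_primeD[OF assms(1), of "{a, a + b}"]) (use assms(2,3) in auto)
  hence "a * z = 0" "(a + b) * z = 0"
    using hull_subset[of "{a, a + b}" semiring_ideal] by (auto simp: annihilator_def)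
  hence "b \<in> annihilator z" by (simp add: annihilator_def distrib_right)
  thus ?thesis using z by blast
qed

section \<open>Content\<close>

lemma semiring_ideal_content: "semiring_ideal (content_ideal lam f)"
  unfolding content_ideal_def by (rule semiring_ideal_Inter) auto

lemma semiring_ideal_extension: "semiring_ideal (ideal_extension lam I)"
  unfolding ideal_extension_def by (rule semiring_ideal_ideal_generated)

text \<open>By the Ohm-Rush condition, the content itself belongs to the family of ideals it is the
  intersection of; it is thus the least ideal whose extension contains \<open>f\<close>.\<close>

lemma content_subset_iff:
  assumes "Ohm_Rush_semialgebra lam" "semiring_ideal I"
  shows "content_ideal lam f \<subseteq> I \<longleftrightarrow> f \<in> ideal_extension lam I"
proof
  assume "content_ideal lam f \<subseteq> I"
  hence "ideal_extension lam (content_ideal lam f) \<subseteq> ideal_extension lam I"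
    unfolding ideal_extension_def by (intro hull_mono image_mono)
  thus "f \<in> ideal_extension lam I" using assms(1) by (auto simp: Ohm_Rush_semialgebra_def)
qed (use assms(2) in \<open>auto simp: content_ideal_def\<close>)

text \<open>Only finitely many elements of the content are needed to generate \<open>f\<close> in
  \<open>B\<close>. The ideal of these elements already has \<open>f\<close> in its extension, so by
  leastness it is the whole content.\<close>

lemma content_finitely_generated:
  assumes "Ohm_Rush_semialgebra lam"
  shows "\<exists>X. finite X \<and> content_ideal lam f = ideal_generated X"
proof -
  have "f \<in> ideal_generated (lam ` content_ideal lam f)"
    using assms by (auto simp: Ohm_Rush_semialgebra_def ideal_extension_def)
  then obtain X where X: "finite X" "X \<subseteq> content_ideal lam f" "f \<in> ideal_generated (lam ` X)"
    using ideal_generated_finite_subset finite_subset_image by metis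
  have "f \<in> ideal_extension lam (ideal_generated X)"
    using X(3) hull_mono[OF image_mono[OF hull_subset[of X semiring_ideal]], of semiring_ideal lam]
    unfolding ideal_extension_def by blast
  hence "content_ideal lam f \<subseteq> ideal_generated X"
    using content_subset_iff[OF assms semiring_ideal_ideal_generated] by blast
  moreover have "ideal_generated X \<subseteq> content_ideal lam f"
    using X(2) semiring_ideal_content by (rule hull_minimal)
  ultimately show ?thesis using X(1) by blast
qed

lemma content_eq_zero_iff:
  assumes "Ohm_Rush_semialgebra lam"
  shows "content_ideal lam f = {0} \<longleftrightarrow> f = 0"
proof -
  have "lam ` {0} = {0}" using assms by (auto simp: Ohm_Rush_semialgebra_def semialgebra_def)
  hence "ideal_extension lam {0} = {0}"
    unfolding ideal_extension_def by (simp add: hull_same[of semiring_ideal, OF semiring_ideal_zero])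
  thus ?thesis
    using content_subset_iff[OF assms semiring_ideal_zero, of f]
      semiring_ideal_0[OF semiring_ideal_content, of lam f] by auto
qed

text \<open>\<open>f * lam z\<close> vanishes exactly when its content is \<open>{0}\<close>, and
  homogeneity computes that content as \<open>z\<close> times the content of
  \<open>f\<close>.\<close>

lemma scalar_mult_eq_zero_iff:
  assumes "Ohm_Rush_semialgebra lam" "homogeneous_content lam"
  shows "f * lam z = 0 \<longleftrightarrow> content_ideal lam f \<subseteq> annihilator z"
proof -
  have "f * lam z = 0 \<longleftrightarrow> (*) z ` content_ideal lam f = {0}"
    using content_eq_zero_iff[OF assms(1), of "lam z * f"] assms(2)
    by (simp add: homogeneous_content_def mult.commute)
  \<comment> \<open>The content contains \<open>0\<close>, so its image is nonempty and equals
    \<open>{0}\<close> as soon as it is contained in \<open>{0}\<close>.\<close>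
  also have "\<dots> \<longleftrightarrow> content_ideal lam f \<subseteq> annihilator z"
    using semiring_ideal_0[OF semiring_ideal_content, of lam f]
    by (force simp: annihilator_def mult.commute)
  finally show ?thesis .
qed

text \<open>Generators of the contents of all members of \<open>Y\<close> form one finite subset of
  \<open>P\<close>, so a single \<open>z\<close> serves the whole of \<open>Y\<close>.\<close>

lemma strong_Krull_prime_annihilates_content:
  assumes "Ohm_Rush_semialgebra lam" "strong_Krull_prime P"
    and "finite Y" "Y \<subseteq> ideal_extension lam P"
  obtains z where "\<forall>f\<in>Y. content_ideal lam f \<subseteq> annihilator z"
    and "annihilator z \<subseteq> P" and "z \<noteq> 0"
proof -
  have P: "semiring_ideal P"
    using assms(2) by (auto simp: strong_Krull_prime_def prime_semiring_ideal_def)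
  obtain X where X: "\<And>f. finite (X f)" "\<And>f. content_ideal lam f = ideal_generated (X f)"
    using content_finitely_generated[OF assms(1)] by metis
  have "X f \<subseteq> P" if "f \<in> Y" for f
    using that assms(4) content_subset_iff[OF assms(1) P, of f] X(2)
      hull_subset[of "X f" semiring_ideal] by blast
  hence "\<Union>(X ` Y) \<subseteq> P" "finite (\<Union>(X ` Y))" using X(1) assms(3) by auto
  then obtain z where z: "ideal_generated (\<Union>(X ` Y)) \<subseteq> annihilator z"
      "annihilator z \<subseteq> P" "z \<noteq> 0"
    using strong_Krull_primeD[OF assms(2)] by blast
  have "content_ideal lam f \<subseteq> annihilator z" if "f \<in> Y" for f
    using that z(1) X(2) hull_mono[of "X f" "\<Union>(X ` Y)" semiring_ideal] by blast
  thus ?thesis using that z(2,3) by blast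
qed

text \<open>If neither factor were in the extension, the two contents would have elements
  \<open>a\<close> and \<open>b\<close> outside \<open>P\<close>; yet weak content puts a power of
  \<open>a * b\<close> into the content of \<open>f * g\<close>, hence into
  \<open>P\<close>.\<close>

lemma prime_extension_mult:
  assumes "weak_content_semialgebra lam" "prime_semiring_ideal P"
    and fg: "f * g \<in> ideal_extension lam P"
  shows "f \<in> ideal_extension lam P \<or> g \<in> ideal_extension lam P"
proof (rule ccontr)
  assume neg: "\<not> ?thesis"
  have OR: "Ohm_Rush_semialgebra lam" using assms(1) by (simp add: weak_content_semialgebra_def)
  have P: "semiring_ideal P" "\<And>a b. a * b \<in> P \<Longrightarrow> a \<in> P \<or> b \<in> P" "P \<noteq> UNIV"
    using assms(2) by (auto simp: prime_semiring_ideal_def)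
  note iff = content_subset_iff[OF OR P(1)]
  obtain a b where ab: "a \<in> content_ideal lam f" "a \<notin> P" "b \<in> content_ideal lam g" "b \<notin> P"
    using neg iff by blast
  have "a * b \<in> ideal_product (content_ideal lam f) (content_ideal lam g)"
    unfolding ideal_product_def using ab by (intro hull_inc) blast
  hence "a * b \<in> ideal_radical (content_ideal lam (f * g))"
    using assms(1) unfolding weak_content_semialgebra_def by blast
  then obtain n where "(a * b) ^ n \<in> P" using fg iff by (auto simp: ideal_radical_def)
  \<comment> \<open>The power is read as a product of \<open>n\<close> equal factors.\<close>
  hence "a * b \<in> P"
    using prime_semiring_ideal_prod[OF assms(2), of "{..<n}" "\<lambda>_. a * b"] by auto
  thus False using P(2) ab by blast
qed

lemma strong_Krull_prime_extension:
  assumes weak: "weak_content_semialgebra lam" and "inj lam" and hom: "homogeneous_content lam"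
    and P: "strong_Krull_prime P"
  shows "strong_Krull_prime (ideal_extension lam P)"
proof -
  have OR: "Ohm_Rush_semialgebra lam" using weak by (simp add: weak_content_semialgebra_def)
  have prime: "prime_semiring_ideal P" using P by (simp add: strong_Krull_prime_def)
  hence "semiring_ideal P" by (simp add: prime_semiring_ideal_def)
  note iff = content_subset_iff[OF OR this]
  note ann = scalar_mult_eq_zero_iff[OF OR hom]
  \<comment> \<open>Otherwise some nonzero \<open>z\<close> would kill the content of
    \<open>1\<close>, so that \<open>lam z = 1 * lam z = 0\<close>, against injectivity.\<close>
  have "1 \<notin> ideal_extension lam P"
  proof
    assume "1 \<in> ideal_extension lam P"
    then obtain z where "content_ideal lam 1 \<subseteq> annihilator z" "z \<noteq> 0"
      by (elim strong_Krull_prime_annihilates_content[OF OR P, of "{1}", simplified]) auto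
    hence "lam z = 0" "z \<noteq> 0" using ann[of 1] by auto
    thus False using \<open>inj lam\<close> OR
      by (metis injD Ohm_Rush_semialgebra_def semialgebra_def)
  qed
  hence "prime_semiring_ideal (ideal_extension lam P)"
    using prime_extension_mult[OF weak prime] semiring_ideal_extension
    unfolding prime_semiring_ideal_def by blast
  moreover have "\<exists>z. I \<subseteq> annihilator z \<and> annihilator z \<subseteq> ideal_extension lam P"
    if I: "fin_gen_ideal I" "I \<subseteq> ideal_extension lam P" for I
  proof -
    obtain Y where Y: "finite Y" "I = ideal_generated Y" using I(1) by (auto simp: fin_gen_ideal_def)
    have "Y \<subseteq> ideal_extension lam P" using I(2) Y(2) hull_subset[of Y semiring_ideal] by blast
    then obtain z where z: "\<forall>f\<in>Y. content_ideal lam f \<subseteq> annihilator z"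
        "annihilator z \<subseteq> P" "z \<noteq> 0"
      by (rule strong_Krull_prime_annihilates_content[OF OR P Y(1)])
    \<comment> \<open>The witness is \<open>lam z\<close>: by \<open>ann\<close> it kills exactly
      the elements of \<open>B\<close> whose content \<open>z\<close> kills.\<close>
    have "Y \<subseteq> annihilator (lam z)" using z(1) ann by (auto simp: annihilator_def)
    hence "I \<subseteq> annihilator (lam z)"
      unfolding Y(2) using semiring_ideal_annihilator by (rule hull_minimal)
    moreover have "annihilator (lam z) \<subseteq> ideal_extension lam P"
    proof
      fix g assume "g \<in> annihilator (lam z)"
      hence "content_ideal lam g \<subseteq> annihilator z" using ann by (simp add: annihilator_def)
      thus "g \<in> ideal_extension lam P" using z(2) iff by blast
    qed
    ultimately show ?thesis by blast
  qed
  ultimately show ?thesis by (simp add: strong_Krull_prime_def)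
qed

theorem theorem4p13:
  fixes lam :: "'s::comm_semiring_1 \<Rightarrow> 'b::comm_semiring_1"
  assumes "McCoy_semialgebra lam"
    and "weak_content_semialgebra lam"
    and "inj lam"
    and "homogeneous_content lam"
    and "finite_union_of_strong_Krull_primes (zero_divisors :: 's set)"
  shows "finite_union_of_strong_Krull_primes (zero_divisors :: 'b set)"
proof -
  have OR: "Ohm_Rush_semialgebra lam" using assms(1) by (simp add: McCoy_semialgebra_def)
  obtain F :: "'s set set" where F: "finite F" "\<And>P. P \<in> F \<Longrightarrow> strong_Krull_prime P"
      "zero_divisors = \<Union>F"
    using assms(5) unfolding finite_union_of_strong_Krull_primes_def by blast
  have "f \<in> zero_divisors \<longleftrightarrow> (\<exists>P\<in>F. f \<in> ideal_extension lam P)" for f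
  proof
    assume "f \<in> zero_divisors"
    then obtain g where "g * f = 0" "g \<noteq> 0" by (auto simp: zero_divisors_def mult.commute)
    then obtain s where s: "s \<noteq> 0" "(*) s ` content_ideal lam f = {0}"
      using assms(1) unfolding McCoy_semialgebra_def by blast
    have "a * s = 0" if "a \<in> content_ideal lam f" for a
      using that s(2) by (force simp: mult.commute)
    hence "content_ideal lam f \<subseteq> \<Union>F"
      using s(1) unfolding F(3)[symmetric] zero_divisors_def by blast
    hence "\<exists>P\<in>F. content_ideal lam f \<subseteq> P"
      by (rule prime_avoidance_subtractive[OF F(1) semiring_ideal_content])
        (use F(2) in \<open>simp add: strong_Krull_prime_def\<close>,
          rule strong_Krull_prime_subtractive[OF F(2)])
    then obtain P where "P \<in> F" "content_ideal lam f \<subseteq> P" by blast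
    moreover from this have "semiring_ideal P"
      using F(2) by (auto simp: strong_Krull_prime_def prime_semiring_ideal_def)
    ultimately show "\<exists>P\<in>F. f \<in> ideal_extension lam P"
      using content_subset_iff[OF OR] by blast
  next
    assume "\<exists>P\<in>F. f \<in> ideal_extension lam P"
    then obtain P where P: "P \<in> F" "f \<in> ideal_extension lam P" by blast
    then obtain z where "content_ideal lam f \<subseteq> annihilator z" "z \<noteq> 0"
      by (elim strong_Krull_prime_annihilates_content[OF OR F(2), of P "{f}", simplified]) auto
    \<comment> \<open>\<open>lam z\<close> witnesses that \<open>f\<close> is a zero-divisor;
      injectivity keeps it nonzero.\<close>
    hence "f * lam z = 0" "lam z \<noteq> 0"
      using scalar_mult_eq_zero_iff[OF OR assms(4)] assms(3) OR
      by (auto simp: Ohm_Rush_semialgebra_def semialgebra_def dest: injD[of lam z 0])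
    thus "f \<in> zero_divisors" by (auto simp: zero_divisors_def)
  qed
  hence "zero_divisors = \<Union>(ideal_extension lam ` F)" by auto
  moreover have "\<forall>Q\<in>ideal_extension lam ` F. strong_Krull_prime Q"
    using strong_Krull_prime_extension[OF assms(2-4)] F(2) by blast
  ultimately show ?thesis
    using F(1) unfolding finite_union_of_strong_Krull_primes_def by blast
qed

end
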